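(* Assume that the equilibrium state $U_*=(\rho_*,m_* )\in\mathbb{R}^2$ with $\rho_*>0$ satisfies the subsonicity condition $p'(\rho_* )>m_*^2/\rho_*^2$. Then the linearized QHD system $$U_t+A_*U_x=B_*U_{xx}+C_*U_{xxx}$$ is symbol symmetrizable, but not symmetrizable in the sense of Friedrichs. One symbol symmetrizer is of the form $$S(\xi)=\begin{pmatrix}\alpha(\xi)&0\\0&1\end{pmatrix}\in C^\infty(\mathbb{R};\mathbb{R}^{2\times2}),$$ where $$\alpha(\xi):=p'(\rho_* )-\frac{m_*^2}{\rho_*^2}+\tfrac12k^2\xi^2>0,\qquad\xi\in\mathbb{R}.$$
   Context: Here $p(\rho)=\rho^\gamma$ with $\gamma>1$, $\mu>0$ and $k>0$ are constants, and $$A_*=\begin{pmatrix}0&1\\ p'(\rho_* )-m_*^2/\rho_*^2&2m_*/\rho_*\end{pmatrix},\quad B_*=\begin{pmatrix}0&0\\0&\mu\end{pmatrix},\quad C_*=\begin{pmatrix}0&0\\ \tfrac12k^2&0\end{pmatrix}.$$ Define the symbols $A(\xi):=A_*+\xi^2C_*$ and $B(\xi):=\xi^2B_*$, so that in Fourier space the system reads $\widehat U_t+(i\xi A(\xi)+B(\xi))\widehat U=0$. Symbol symmetrizable: there exists a smooth, symmetric, positive definite matrix-valued function $S=S(\xi)>0$ such that $S(\xi)A(\xi)$ and $S(\xi)B(\xi)$ are symmetric, with $S(\xi)B(\xi)\ge0$ (positive semi-definite), for all $\xi\in\mathbb{R}$; such an $S$ is a symbol symmetrizer. Symmetrizable in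 the sense of Friedrichs: there exists a constant symmetric positive definite matrix $S>0$ such that $SA_*$, $SB_*$ and $SC_*$ are all simultaneously symmetric. *)

theory Defs
  imports "HOL-Analysis.Analysis"
begin

definition symmetric_mat :: "real^'n^'n \<Rightarrow> bool" where
  "symmetric_mat M \<longleftrightarrow> transpose M = M"

text \<open>Symmetry is not part of the next two notions; it is always required separately.\<close>

definition pos_definite :: "real^'n^'n \<Rightarrow> bool" where
  "pos_definite M \<longleftrightarrow> (\<forall>v. v \<noteq> 0 \<longrightarrow> v \<bullet> (M *v v) > 0)"

definition pos_semidefinite :: "real^'n^'n \<Rightarrow> bool" where
  "pos_semidefinite M \<longleftrightarrow> (\<forall>v. v \<bullet> (M *v v) \<ge> 0)"

text \<open>\<open>C\<^sup>\<infinity>\<close> on the real line: \<open>D n\<close> is the \<open>n\<close>-th derivative of \<open>f\<close>.\<close>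

definition smooth :: "(real \<Rightarrow> 'a::real_normed_vector) \<Rightarrow> bool" where
  "smooth f \<longleftrightarrow> (\<exists>D :: nat \<Rightarrow> real \<Rightarrow> 'a. D 0 = f \<and>
     (\<forall>n x. (D n has_vector_derivative D (Suc n) x) (at x)))"

text \<open>
  The constant-coefficient system \<open>U\<^sub>t + A U\<^sub>x = B U\<^sub>x\<^sub>x + C U\<^sub>x\<^sub>x\<^sub>x\<close> is given by its coefficient
  matrices. Since \<open>\<partial>\<^sub>x\<close> becomes multiplication by \<open>i \<xi>\<close> in Fourier space, it reads there
  \<open>U\<^sub>t + (i \<xi> A(\<xi>) + B(\<xi>)) U = 0\<close> with the following real symbols.
\<close>

definition symbol_A :: "real^'n^'n \<Rightarrow> real^'n^'n \<Rightarrow> real \<Rightarrow> real^'n^'n" where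
  "symbol_A A C \<xi> = A + \<xi>\<^sup>2 *\<^sub>R C"

definition symbol_B :: "real^'n^'n \<Rightarrow> real \<Rightarrow> real^'n^'n" where
  "symbol_B B \<xi> = \<xi>\<^sup>2 *\<^sub>R B"

definition symbol_symmetrizer ::
  "real^'n^'n \<Rightarrow> real^'n^'n \<Rightarrow> real^'n^'n \<Rightarrow> (real \<Rightarrow> real^'n^'n) \<Rightarrow> bool" where
  "symbol_symmetrizer A B C S \<longleftrightarrow>
     smooth S \<and>
     (\<forall>\<xi>. symmetric_mat (S \<xi>) \<and> pos_definite (S \<xi>) \<and>
          symmetric_mat (S \<xi> ** symbol_A A C \<xi>) \<and>
          symmetric_mat (S \<xi> ** symbol_B B \<xi>) \<and>
          pos_semidefinite (S \<xi> ** symbol_B B \<xi>))"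

definition symbol_symmetrizable ::
  "real^'n^'n \<Rightarrow> real^'n^'n \<Rightarrow> real^'n^'n \<Rightarrow> bool" where
  "symbol_symmetrizable A B C \<longleftrightarrow> (\<exists>S. symbol_symmetrizer A B C S)"

definition friedrichs_symmetrizable ::
  "real^'n^'n \<Rightarrow> real^'n^'n \<Rightarrow> real^'n^'n \<Rightarrow> bool" where
  "friedrichs_symmetrizable A B C \<longleftrightarrow>
     (\<exists>S. symmetric_mat S \<and> pos_definite S \<and>
          symmetric_mat (S ** A) \<and> symmetric_mat (S ** B) \<and> symmetric_mat (S ** C))"

definition pressure :: "real \<Rightarrow> real \<Rightarrow> real" where
  "pressure \<gamma> \<rho> = \<rho> powr \<gamma>"

text \<open>The coefficient matrices, written row by row.\<close>

definition qhd_A :: "real \<Rightarrow> real \<Rightarrow> real \<Rightarrow> real^2^2" where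
  "qhd_A \<gamma> \<rho> m = vector [vector [0, 1],
                         vector [deriv (pressure \<gamma>) \<rho> - m\<^sup>2 / \<rho>\<^sup>2, 2 * m / \<rho>]]"

definition qhd_B :: "real \<Rightarrow> real^2^2" where
  "qhd_B \<mu> = vector [vector [0, 0], vector [0, \<mu>]]"

definition qhd_C :: "real \<Rightarrow> real^2^2" where
  "qhd_C k = vector [vector [0, 0], vector [k\<^sup>2 / 2, 0]]"

definition qhd_alpha :: "real \<Rightarrow> real \<Rightarrow> real \<Rightarrow> real \<Rightarrow> real \<Rightarrow> real" where
  "qhd_alpha \<gamma> k \<rho> m \<xi> = deriv (pressure \<gamma>) \<rho> - m\<^sup>2 / \<rho>\<^sup>2 + k\<^sup>2 / 2 * \<xi>\<^sup>2"

end

theory Submission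
  imports Defs
begin

text \<open>
  Every matrix \<open>A(\<xi>) = A\<^sub>* + \<xi>\<^sup>2 C\<^sub>*\<close> is a companion matrix with rows \<open>(0, 1)\<close> and \<open>(\<alpha>(\<xi>), b)\<close>,
  where \<open>b = 2 m\<^sub>* / \<rho>\<^sub>*\<close>: the dispersion matrix \<open>C\<^sub>*\<close> only has an entry at the place of
  \<open>p'(\<rho>\<^sub>*) - m\<^sub>*\<^sup>2 / \<rho>\<^sub>*\<^sup>2\<close>. A companion matrix becomes symmetric when its first row is scaled by
  its lower left entry (lemma \<open>symmetric_mat_diag_times_companion\<close>), so \<open>S = diag(\<alpha>, 1)\<close>
  symmetrizes \<open>A(\<xi>)\<close>. Subsonicity makes \<open>\<alpha>\<close> and hence \<open>S\<close> positive. The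
  viscosity acts on the second component only, where \<open>S\<close> is the identity, so
  \<open>S(\<xi>) B(\<xi>) = B(\<xi>)\<close>, which is symmetric and nonnegative. Finally \<open>\<alpha>\<close> is a quadratic polynomial
  in \<open>\<xi>\<close>, so \<open>S\<close> is smooth.

  The scaling \<open>\<alpha>(\<xi>)\<close> must depend on the frequency because of \<open>C\<^sub>*\<close>, which is nilpotent and
  nonzero. A matrix with a symmetrizer is self-adjoint for the inner product that the symmetrizer
  defines, hence diagonalizable, so no constant \<open>S > 0\<close> symmetrizes \<open>C\<^sub>*\<close>. In coordinates,
  symmetry of \<open>S C\<^sub>*\<close> forces the lower right entry of \<open>S\<close>, the value of its quadratic form at
  the second basis vector, to vanish (lemma \<open>not_friedrichs_symmetrizable_qhd\<close>).
\<close>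

lemma symmetric_mat_2: "symmetric_mat (M :: real^2^2) \<longleftrightarrow> M $ 1 $ 2 = M $ 2 $ 1"
  by (auto simp: symmetric_mat_def transpose_def vec_eq_iff forall_2)

lemma quadratic_form_2:
  fixes M :: "real^2^2"
  shows "v \<bullet> (M *v v) = M $ 1 $ 1 * (v $ 1)\<^sup>2 + (M $ 1 $ 2 + M $ 2 $ 1) * v $ 1 * v $ 2
    + M $ 2 $ 2 * (v $ 2)\<^sup>2"
  by (simp add: inner_vec_def matrix_vector_mult_def sum_2 power2_eq_square algebra_simps)

lemma pos_definite_imp_diagonal_pos:
  fixes M :: "real^'n^'n"
  assumes "pos_definite M"
  shows "M $ i $ i > 0"
proof -
  have "axis i 1 \<bullet> (M *v axis i 1) > 0"
    using assms by (simp add: pos_definite_def axis_eq_0_iff)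
  then show ?thesis
    by (simp add: matrix_vector_mult_basis inner_axis' column_def)
qed

lemma pos_definite_diag:
  fixes a d :: real
  assumes "a > 0" and "d > 0"
  shows "pos_definite (vector [vector [a, 0], vector [0, d]] :: real^2^2)"
  unfolding pos_definite_def
proof (intro allI impI)
  fix v :: "real^2"
  assume "v \<noteq> 0"
  then have "v $ 1 \<noteq> 0 \<or> v $ 2 \<noteq> 0"
    by (auto simp: vec_eq_iff forall_2)
  then have "a * (v $ 1)\<^sup>2 + d * (v $ 2)\<^sup>2 > 0"
    using assms by (auto intro: add_pos_nonneg add_nonneg_pos)
  then show "v \<bullet> ((vector [vector [a, 0], vector [0, d]] :: real^2^2) *v v) > 0"
    by (simp add: quadratic_form_2)
qed

lemma symmetric_mat_diag_times_companion:
  fixes a b :: real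
  shows "symmetric_mat ((vector [vector [a, 0], vector [0, 1]] :: real^2^2)
    ** vector [vector [0, 1], vector [a, b]])"
  by (simp add: symmetric_mat_2 matrix_matrix_mult_def sum_2)

lemma smooth_quadratic:
  fixes P Q :: "'a::real_normed_vector"
  shows "smooth (\<lambda>x. P + x\<^sup>2 *\<^sub>R Q)"
proof -
  define D where "D n x = (if n = 0 then P + x\<^sup>2 *\<^sub>R Q else if n = 1 then (2 * x) *\<^sub>R Q
     else if n = 2 then 2 *\<^sub>R Q else 0)" for n :: nat and x :: real
  have "(D n has_vector_derivative D (Suc n) x) (at x)" for n x
  proof -
    consider "n = 0" | "n = 1" | "n = 2" | "n > 2"
      by linarith
    then show ?thesis
      by cases (auto simp: D_def[abs_def] intro!: derivative_eq_intros)
  qed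
  moreover have "D 0 = (\<lambda>x. P + x\<^sup>2 *\<^sub>R Q)"
    by (simp add: D_def fun_eq_iff)
  ultimately show ?thesis
    unfolding smooth_def by blast
qed

lemma qhd_alpha_pos:
  assumes "deriv (pressure \<gamma>) \<rho> > m\<^sup>2 / \<rho>\<^sup>2"
  shows "qhd_alpha \<gamma> k \<rho> m \<xi> > 0"
  unfolding qhd_alpha_def using assms by (intro add_pos_nonneg) auto

lemma symbol_A_qhd_companion:
  "symbol_A (qhd_A \<gamma> \<rho> m) (qhd_C k) \<xi>
     = vector [vector [0, 1], vector [qhd_alpha \<gamma> k \<rho> m \<xi>, 2 * m / \<rho>]]"
  by (simp add: symbol_A_def qhd_A_def qhd_C_def qhd_alpha_def vec_eq_iff forall_2)

lemma diag_times_symbol_B_qhd: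
  "(vector [vector [a, 0], vector [0, 1]] :: real^2^2) ** symbol_B (qhd_B \<mu>) \<xi>
     = symbol_B (qhd_B \<mu>) \<xi>"
  by (simp add: symbol_B_def qhd_B_def vec_eq_iff forall_2 matrix_matrix_mult_def sum_2)

lemma symbol_symmetrizer_qhd:
  assumes subsonic: "deriv (pressure \<gamma>) \<rho> > m\<^sup>2 / \<rho>\<^sup>2" and "\<mu> \<ge> 0"
  shows "symbol_symmetrizer (qhd_A \<gamma> \<rho> m) (qhd_B \<mu>) (qhd_C k)
    (\<lambda>\<xi>. vector [vector [qhd_alpha \<gamma> k \<rho> m \<xi>, 0], vector [0, 1]])"
proof -
  let ?S = "\<lambda>\<xi>. vector [vector [qhd_alpha \<gamma> k \<rho> m \<xi>, 0], vector [0, 1]] :: real^2^2"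
  have "?S = (\<lambda>\<xi>. vector [vector [deriv (pressure \<gamma>) \<rho> - m\<^sup>2 / \<rho>\<^sup>2, 0], vector [0, 1]]
      + \<xi>\<^sup>2 *\<^sub>R vector [vector [k\<^sup>2 / 2, 0], vector [0, 0]])"
    by (simp add: fun_eq_iff qhd_alpha_def vec_eq_iff forall_2)
  then have "smooth ?S"
    by (simp only: smooth_quadratic)
  moreover have "symmetric_mat (?S \<xi>)" for \<xi>
    by (simp add: symmetric_mat_2)
  moreover have "pos_definite (?S \<xi>)" for \<xi>
    using qhd_alpha_pos[OF subsonic] by (simp add: pos_definite_diag)
  moreover have "symmetric_mat (?S \<xi> ** symbol_A (qhd_A \<gamma> \<rho> m) (qhd_C k) \<xi>)" for \<xi>
    by (simp add: symbol_A_qhd_companion symmetric_mat_diag_times_companion)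
  moreover have "symmetric_mat (?S \<xi> ** symbol_B (qhd_B \<mu>) \<xi>)" for \<xi>
    by (simp add: diag_times_symbol_B_qhd) (simp add: symmetric_mat_2 symbol_B_def qhd_B_def)
  moreover have "pos_semidefinite (?S \<xi> ** symbol_B (qhd_B \<mu>) \<xi>)" for \<xi>
    using \<open>\<mu> \<ge> 0\<close>
    by (simp add: diag_times_symbol_B_qhd)
       (simp add: pos_semidefinite_def quadratic_form_2 symbol_B_def qhd_B_def)
  ultimately show ?thesis
    unfolding symbol_symmetrizer_def by blast
qed

text \<open>
  The off-diagonal entries of \<open>S C\<^sub>*\<close> are \<open>0\<close> and \<open>S\<^sub>2\<^sub>2 k\<^sup>2 / 2\<close>, and \<open>S\<^sub>2\<^sub>2 > 0\<close>, so the
  obstruction lies in the dispersion matrix.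
\<close>

lemma not_friedrichs_symmetrizable_qhd:
  assumes "k \<noteq> 0"
  shows "\<not> friedrichs_symmetrizable A B (qhd_C k)"
proof
  assume "friedrichs_symmetrizable A B (qhd_C k)"
  then obtain S :: "real^2^2" where "pos_definite S" and "symmetric_mat (S ** qhd_C k)"
    unfolding friedrichs_symmetrizable_def by blast
  then have "S $ 2 $ 2 > 0" and "S $ 2 $ 2 * k\<^sup>2 = 0"
    by (auto simp: pos_definite_imp_diagonal_pos symmetric_mat_2 qhd_C_def
        matrix_matrix_mult_def sum_2)
  with assms show False
    by simp
qed

theorem lemma5:
  fixes \<gamma> \<mu> k \<rho> m :: real
  assumes "\<gamma> > 1" and "\<mu> > 0" and "k > 0"
    and "\<rho> > 0"
    and subsonic: "deriv (pressure \<gamma>) \<rho> > m\<^sup>2 / \<rho>\<^sup>2"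
  shows "symbol_symmetrizable (qhd_A \<gamma> \<rho> m) (qhd_B \<mu>) (qhd_C k)
       \<and> \<not> friedrichs_symmetrizable (qhd_A \<gamma> \<rho> m) (qhd_B \<mu>) (qhd_C k)
       \<and> (\<forall>\<xi>. qhd_alpha \<gamma> k \<rho> m \<xi> > 0)
       \<and> symbol_symmetrizer (qhd_A \<gamma> \<rho> m) (qhd_B \<mu>) (qhd_C k)
           (\<lambda>\<xi>. vector [vector [qhd_alpha \<gamma> k \<rho> m \<xi>, 0], vector [0, 1]])"
  using symbol_symmetrizer_qhd[OF subsonic] qhd_alpha_pos[OF subsonic]
    not_friedrichs_symmetrizable_qhd \<open>\<mu> > 0\<close> \<open>k > 0\<close>
  unfolding symbol_symmetrizable_def by (metis less_imp_le less_irrefl)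

end
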